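(* Let $k\ge 2$, $\mathcal{A}_k=\{1,\dots,k\}$, and let $X$ be an Arnoux-Rauzy subshift over $\mathcal{A}_k$ with index sequence $(i_n)_{n\ge 1}$. Then $X$ is linearly recurrent if and only if every letter $a\in\mathcal{A}_k$ occurs in $(i_n)$ with bounded gaps (that is, there is $g\in\mathbb{N}$ such that for every $a \in \mathcal{A}_k$ and every $m\in\mathbb{N}$ at least one of $i_m,\dots,i_{m+g-1}$ equals $a$).
   Context: $\mathbb{N}=\{1,2,\dots\}$. For $x\in\mathcal{A}_k^{\mathbb{N}}$ or $\mathcal{A}_k^{\mathbb{Z}}$, $F_x(n)$ is the set of factors (contiguous subwords) of $x$ of length $n$, and $F_x=\bigcup_n F_x(n)$. A factor $u$ is right-special if there are letters $a\ne b$ with $ua,ub\in F_x$; left-special if there are $a\neq b$ with $au,bu\in F_x$; bispecial if both. The empty word $\varepsilon$ is counted as a bispecial factor. The sequence $x$ is an Arnoux-Rauzy (AR) sequence if (1) $x$ is uniformly recurrent (each factor occurs with bounded gaps), (2) $|F_x(n)|=(k-1)n+1$ for all $n\in\mathbb{N}$, and (3) for each $n$, $F_x(n)$ contains exactly one right-special factor and exactly one left-special factor. The associated AR subshift is $X=\{y\in\mathcal{A}_k^{\mathbb{N}} \text{ (or } \mathcal{A}_k^{\mathbb{Z}}) : F_y(n)=F_x(n)\ \forall n\in\mathbb{N}\}$ (one-sided, resp. two-sided); all its elements have the same factors, and one writes $F_X$ for $F_x$. Index sequence: let $\varepsilon=w_1,w_2,w_3,\dots$ be the bispecial factors ordered so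 that $0=|w_1|<|w_2|<\cdots$. Then $i_n\in\mathcal{A}_k$ is the unique letter such that $i_nw_n$ is right-special. $X$ is called linearly recurrent if there is a constant $K>0$ such that every $w\in F_X$ is contained (as a subword) in every $v\in F_X$ of length at least $K|w|$. *)

theory Defs
  imports Complex_Main "HOL-Library.Sublist"
begin

text \<open>
  The alphabet is \<open>{1..k}\<close> inside the natural numbers. A sequence is a function
  \<open>'p \<Rightarrow> nat\<close> on positions; \<open>'p = nat\<close> gives one-sided sequences (positions starting
  at 0, a harmless shift of the convention \<open>1, 2, \<dots>\<close>) and \<open>'p = int\<close> gives
  two-sided ones. All notions are stated once for both.
\<close>

definition word_at :: "('p::semiring_1 \<Rightarrow> nat) \<Rightarrow> 'p \<Rightarrow> nat \<Rightarrow> nat list" where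
  "word_at x p n = map (\<lambda>j. x (p + of_nat j)) [0..<n]"

definition factors_of_length :: "('p::semiring_1 \<Rightarrow> nat) \<Rightarrow> nat \<Rightarrow> nat list set" where
  "factors_of_length x n = {word_at x p n | p. True}"

text \<open>The length \<open>n = 0\<close> is included, so the empty word is a factor.\<close>

definition factors :: "('p::semiring_1 \<Rightarrow> nat) \<Rightarrow> nat list set" where
  "factors x = (\<Union>n. factors_of_length x n)"

text \<open>
  Special words are defined relative to a set \<open>L\<close> of factors. The empty word is bispecial as
  soon as two different letters occur, so it needs no separate clause.
\<close>

definition right_special :: "nat list set \<Rightarrow> nat list \<Rightarrow> bool" where
  "right_special L u \<longleftrightarrow> u \<in> L \<and> (\<exists>a b. a \<noteq> b \<and> u @ [a] \<in> L \<and> u @ [b] \<in> L)"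

definition left_special :: "nat list set \<Rightarrow> nat list \<Rightarrow> bool" where
  "left_special L u \<longleftrightarrow> u \<in> L \<and> (\<exists>a b. a \<noteq> b \<and> a # u \<in> L \<and> b # u \<in> L)"

definition bispecial :: "nat list set \<Rightarrow> nat list \<Rightarrow> bool" where
  "bispecial L u \<longleftrightarrow> right_special L u \<and> left_special L u"

definition uniformly_recurrent :: "('p::semiring_1 \<Rightarrow> nat) \<Rightarrow> bool" where
  "uniformly_recurrent x \<longleftrightarrow>
     (\<forall>u\<in>factors x. \<exists>g. \<forall>p. \<exists>j<g. word_at x (p + of_nat j) (length u) = u)"

definition AR_sequence :: "nat \<Rightarrow> ('p::semiring_1 \<Rightarrow> nat) \<Rightarrow> bool" where
  "AR_sequence k x \<longleftrightarrow>
     range x \<subseteq> {1..k} \<and>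
     uniformly_recurrent x \<and>
     (\<forall>n\<ge>1. card (factors_of_length x n) = (k - 1) * n + 1) \<and>
     (\<forall>n\<ge>1. (\<exists>!u. u \<in> factors_of_length x n \<and> right_special (factors x) u) \<and>
             (\<exists>!u. u \<in> factors_of_length x n \<and> left_special (factors x) u))"

definition AR_subshift :: "nat \<Rightarrow> ('p::semiring_1 \<Rightarrow> nat) set \<Rightarrow> bool" where
  "AR_subshift k X \<longleftrightarrow>
     (\<exists>x :: 'p \<Rightarrow> nat. AR_sequence k x \<and>
          X = {y. range y \<subseteq> {1..k} \<and>
                  (\<forall>n\<ge>1. factors_of_length y n = factors_of_length x n)})"

definition language :: "('p::semiring_1 \<Rightarrow> nat) set \<Rightarrow> nat list set" where
  "language X = (\<Union>y\<in>X. factors y)"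

text \<open>Below, \<open>w\<close> and \<open>i\<close> are indexed from 1; their values at 0 are irrelevant.\<close>

definition bispecial_enumeration :: "nat list set \<Rightarrow> (nat \<Rightarrow> nat list) \<Rightarrow> bool" where
  "bispecial_enumeration L w \<longleftrightarrow>
     w 1 = [] \<and> w ` {1..} = {u. bispecial L u} \<and>
     (\<forall>n\<ge>1. length (w n) < length (w (n + 1)))"

text \<open>
  The equivalence in the last line says both that \<open>i n # w n\<close> is right-special and that
  \<open>i n\<close> is the only letter with this property.
\<close>

definition index_sequence :: "('p::semiring_1 \<Rightarrow> nat) set \<Rightarrow> (nat \<Rightarrow> nat) \<Rightarrow> bool" where
  "index_sequence X i \<longleftrightarrow>
     (\<exists>w. bispecial_enumeration (language X) w \<and>
          (\<forall>n\<ge>1. \<forall>a. right_special (language X) (a # w n) \<longleftrightarrow> a = i n))"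

definition linearly_recurrent :: "('p::semiring_1 \<Rightarrow> nat) set \<Rightarrow> bool" where
  "linearly_recurrent X \<longleftrightarrow>
     (\<exists>K::real. K > 0 \<and>
        (\<forall>w\<in>language X. \<forall>v\<in>language X.
           real (length v) \<ge> K * real (length w) \<longrightarrow> sublist w v))"

definition bounded_gaps :: "nat \<Rightarrow> (nat \<Rightarrow> nat) \<Rightarrow> bool" where
  "bounded_gaps k i \<longleftrightarrow>
     (\<exists>g\<ge>1. \<forall>a\<in>{1..k}. \<forall>m\<ge>1. \<exists>j\<in>{m..<m + g}. i j = a)"

end

theory Submission
  imports Defs
begin

text \<open>
  Both properties depend only on the language \<open>L\<close> of the subshift, so one-sided and two-sided
  subshifts are treated together. The proof follows the return words of the bispecial factors
  \<open>w\<^sub>n\<close>. For a letter \<open>a\<close>, the factor \<open>a w\<^sub>n\<close> has only one left extension up to the previous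
  occurrence of \<open>w\<^sub>n\<close>, because a left special word met on the way would begin with \<open>w\<^sub>n\<close>. Hence
  there is exactly one word \<open>R\<^sub>n(a)\<close> ending in \<open>a\<close> such that \<open>R\<^sub>n(a) w\<^sub>n\<close> is a factor in which
  \<open>w\<^sub>n\<close> occurs exactly twice, at the beginning and at the end. Every factor is thus cut by the
  occurrences of \<open>w\<^sub>n\<close> into blocks \<open>R\<^sub>n(a)\<close>, and passing to the next bispecial factor changes the
  blocks in a simple way: with \<open>i = i\<^sub>n\<close>,

  \<open>w\<^sub>n\<^sub>+\<^sub>1 = R\<^sub>n(i) w\<^sub>n\<close>, \<open>R\<^sub>n\<^sub>+\<^sub>1(i) = R\<^sub>n(i)\<close> and \<open>R\<^sub>n\<^sub>+\<^sub>1(a) = R\<^sub>n(i) R\<^sub>n(a)\<close> for \<open>a \<noteq> i\<close>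

  (\<open>next_bispecial\<close>, \<open>return_system_step\<close>). In particular \<open>|R\<^sub>n(a)| \<le> |w\<^sub>n| + 1\<close>, so \<open>|w\<^sub>n| + 1\<close> at
  most doubles in each step.

  Suppose that the gaps are bounded by \<open>g\<close>. A nonempty factor \<open>u\<close> with
  \<open>|w\<^sub>n\<^sub>-\<^sub>1| < |u| \<le> |w\<^sub>n|\<close> lies in some \<open>R\<^sub>n(a) w\<^sub>n\<close>. This word lies in \<open>w\<^sub>n\<^sub>+\<^sub>g\<close>, since \<open>a\<close> is one of
  the next \<open>g\<close> indices, and \<open>w\<^sub>n\<^sub>+\<^sub>g\<close> lies in every factor of length \<open>2 (|w\<^sub>n\<^sub>+\<^sub>g| + 1)\<close>, which is at most
  \<open>2\<^sup>g\<^sup>+\<^sup>2 |u|\<close>.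

  Suppose conversely that the subshift is linearly recurrent with constant \<open>K\<close>. Then
  \<open>|w\<^sub>n| < K |R\<^sub>n(b)|\<close> for every \<open>b\<close>: otherwise all factors of length \<open>p = |R\<^sub>n(b)|\<close> would occur in
  \<open>w\<^sub>n\<close>, which has period \<open>p\<close> and so at most \<open>p\<close> such factors, whereas \<open>L\<close> has more than \<open>p\<close> of
  them. Hence \<open>|w\<^sub>n|\<close> grows at least by the factor \<open>1 + 1/K\<close> in each step, and for a suitable \<open>g\<close> depending on
  \<open>K\<close> alone \<open>w\<^sub>n\<^sub>+\<^sub>g\<close> is long enough to contain \<open>a w\<^sub>n\<close> for every letter \<open>a\<close>. But \<open>w\<^sub>n\<^sub>+\<^sub>g\<close> is built
  from \<open>w\<^sub>n\<close> and the blocks of the letters \<open>i\<^sub>n, ..., i\<^sub>n\<^sub>+\<^sub>g\<^sub>-\<^sub>1\<close>, so \<open>a\<close> is among them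
  (\<open>marked_occurrence\<close>).
\<close>

section \<open>Combinatorics of words\<close>

lemma suffix_parallel_decomp:
  assumes "\<not> suffix u v" "\<not> suffix v u"
  obtains s x s' y t where "u = s @ x # t" "v = s' @ y # t" "x \<noteq> y"
proof -
  have "rev u \<parallel> rev v"
    using assms by (intro parallelI) (simp_all add: suffix_to_prefix)
  then obtain as b bs c cs where *: "b \<noteq> c" "rev u = as @ b # bs" "rev v = as @ c # cs"
    using parallel_decomp by blast
  then have "u = rev bs @ b # rev as" "v = rev cs @ c # rev as"
    by (simp_all add: rev_swap)
  with that *(1) show thesis by blast
qed

lemma prefix_append_trans:
  assumes "prefix w (u @ w)" "prefix w v"
  shows "prefix w (u @ v)"
  using assms by (metis prefix_order.trans same_prefix_prefix)

text \<open>An occurrence of \<open>c # u\<close> that starts inside \<open>x\<close> reaches at most \<open>length u\<close> letters into what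
  follows, so it sees no more than the prefix \<open>w\<close> of \<open>v\<close>.\<close>

lemma sublist_append_overlap:
  assumes "prefix w v" "length u \<le> length w" "sublist (c # u) (x @ v)"
  shows "sublist (c # u) (x @ w) \<or> sublist (c # u) v"
proof -
  consider "sublist (c # u) x" | "sublist (c # u) v"
    | u1 u2 where "c # u = u1 @ u2" "suffix u1 x" "prefix u2 v"
    using assms(3) unfolding sublist_append by blast
  then show ?thesis
  proof cases
    case 1
    then show ?thesis by (simp add: sublist_append)
  next
    case 3
    show ?thesis
    proof (cases u1)
      case Nil
      with 3 show ?thesis by auto
    next
      case (Cons b u1')
      with 3(1) assms(2) have "length u2 \<le> length w" by auto
      with 3(3) assms(1) have "prefix u2 w" using prefix_length_prefix by blast
      with 3 show ?thesis unfolding sublist_append by blast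
    qed
  qed simp
qed

text \<open>The first hypothesis says that \<open>w\<close> has period \<open>length R\<close>. An occurrence can be moved to the
  left by one period as long as it starts at position \<open>length R\<close> or later.\<close>

lemma occurrence_before_period:
  assumes "prefix w (R @ w)" "R \<noteq> []" "w = y @ u @ t"
  shows "\<exists>y' t'. w = y' @ u @ t' \<and> length y' < length R"
  using assms(3)
proof (induction "length y" arbitrary: y t rule: less_induct)
  case less
  show ?case
  proof (cases "length y < length R")
    case True
    with less.prems show ?thesis by blast
  next
    case False
    have "prefix y (R @ w)" using assms(1) less.prems
      by (metis prefixI prefix_order.trans)
    with False obtain y1 where y1: "y = R @ y1"
      by (metis linorder_not_less prefix_length_prefix prefixE prefixI)
    with assms(1) less.prems have "prefix (y1 @ u @ t) w" by simp
    then obtain z where "w = y1 @ u @ (t @ z)" by (auto simp: prefix_def)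
    moreover have "length y1 < length y" using y1 assms(2) by simp
    ultimately show ?thesis using less.hyps by blast
  qed
qed

lemma card_factors_of_periodic:
  assumes "prefix w (R @ w)" "R \<noteq> []"
  shows "finite {u. length u = p \<and> sublist u w}"
    and "card {u. length u = p \<and> sublist u w} \<le> length R"
proof -
  have "{u. length u = p \<and> sublist u w} \<subseteq> (\<lambda>s. take p (drop s w)) ` {..<length R}"
  proof
    fix u assume "u \<in> {u. length u = p \<and> sublist u w}"
    then obtain y t where "w = y @ u @ t" "length u = p" by (auto simp: sublist_def)
    then obtain y' t' where y': "w = y' @ u @ t'" "length y' < length R"
      using occurrence_before_period[OF assms] by blast
    then have "u = take p (drop (length y') w)" using \<open>length u = p\<close> by simp
    with y' show "u \<in> (\<lambda>s. take p (drop s w)) ` {..<length R}" by blast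
  qed
  then show "finite {u. length u = p \<and> sublist u w}"
    "card {u. length u = p \<and> sublist u w} \<le> length R"
    using finite_subset card_mono card_image_le
    by (blast, metis (no_types, lifting) card_lessThan card_image_le card_mono finite_imageI
        finite_lessThan le_trans)
qed

section \<open>Return words\<close>

text \<open>The properties of the set of factors of an Arnoux-Rauzy sequence from which everything else
  follows. The last three encode the complexity: a special factor has all its extensions, and the
  language is richer than that of a periodic sequence.\<close>

locale AR_language =
  fixes L :: "nat list set" and A :: "nat set"
  assumes factorial: "v \<in> L \<Longrightarrow> sublist u v \<Longrightarrow> u \<in> L"
    and alphabet: "u \<in> L \<Longrightarrow> set u \<subseteq> A"
    and left_extendable: "u \<in> L \<Longrightarrow> \<exists>a. a # u \<in> L"
    and right_extendable: "u \<in> L \<Longrightarrow> \<exists>a. u @ [a] \<in> L"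
    and recurrent: "u \<in> L \<Longrightarrow> \<exists>G. \<forall>v\<in>L. length v \<ge> G \<longrightarrow> sublist u v"
    and right_special_unique:
      "right_special L u \<Longrightarrow> right_special L v \<Longrightarrow> length u = length v \<Longrightarrow> u = v"
    and left_special_unique:
      "left_special L u \<Longrightarrow> left_special L v \<Longrightarrow> length u = length v \<Longrightarrow> u = v"
    and right_special_full: "right_special L u \<Longrightarrow> a \<in> A \<Longrightarrow> u @ [a] \<in> L"
    and left_special_full: "left_special L u \<Longrightarrow> a \<in> A \<Longrightarrow> a # u \<in> L"
    and many_factors: "n \<ge> 1 \<Longrightarrow> card {u \<in> L. length u = n} > n"
begin

text \<open>\<open>R a @ w\<close> is the complete return word of \<open>w\<close> in which the second occurrence of \<open>w\<close> is preceded
  by the letter \<open>a\<close>. Naming return words by their last letter, and not by the letter after the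
  first occurrence of \<open>w\<close>, is what relates them to the index letter \<open>i\<close>, which is defined by
  extending \<open>w\<close> to the left.\<close>

definition return_system :: "nat list \<Rightarrow> (nat \<Rightarrow> nat list) \<Rightarrow> bool" where
  "return_system w R \<longleftrightarrow>
     (\<forall>a\<in>A. R a \<noteq> [] \<and> last (R a) = a \<and> R a @ w \<in> L \<and> prefix w (R a @ w) \<and>
            (\<forall>s t. R a @ w = s @ w @ t \<longrightarrow> s = [] \<or> t = []))"

lemma return_systemD:
  assumes "return_system w R" "a \<in> A"
  shows "R a \<noteq> []" "last (R a) = a" "R a @ w \<in> L" "prefix w (R a @ w)"
    "R a @ w = s @ w @ t \<Longrightarrow> s = [] \<or> t = []"
  using assms unfolding return_system_def by blast+

lemma right_special_suffix: "right_special L u \<Longrightarrow> suffix s u \<Longrightarrow> right_special L s"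
  unfolding right_special_def suffix_def
  by (metis append.assoc factorial sublist_append_leftI)

lemma left_special_prefix: "left_special L u \<Longrightarrow> prefix s u \<Longrightarrow> left_special L s"
  unfolding left_special_def prefix_def
  by (metis append_Cons factorial sublist_append_rightI)

lemma left_special_begins:
  assumes "left_special L u" "left_special L w" "length w \<le> length u"
  shows "prefix w u"
proof -
  have "left_special L (take (length w) u)"
    using assms(1) left_special_prefix take_is_prefix by blast
  with assms have "take (length w) u = w" using left_special_unique by simp
  then show ?thesis by (metis take_is_prefix)
qed

lemma right_special_ends:
  assumes "right_special L u" "right_special L w" "length w \<le> length u"
  shows "suffix w u"
proof -
  have "right_special L (drop (length u - length w) u)"
    using assms(1) right_special_suffix suffix_drop by blast
  with assms have "drop (length u - length w) u = w" using right_special_unique by simp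
  then show ?thesis by (metis suffix_drop)
qed

lemma left_extend_many:
  assumes "u \<in> L"
  shows "\<exists>y. length y = n \<and> y @ u \<in> L"
proof (induction n)
  case 0 show ?case using assms by simp
next
  case (Suc n)
  then obtain y where "length y = n" "y @ u \<in> L" by blast
  with left_extendable obtain a where "a # y @ u \<in> L" by blast
  with \<open>length y = n\<close> show ?case by (intro exI[of _ "a # y"]) simp
qed

lemma right_extend_many:
  assumes "u \<in> L"
  shows "\<exists>y. length y = n \<and> u @ y \<in> L"
proof (induction n)
  case 0 show ?case using assms by simp
next
  case (Suc n)
  then obtain y where "length y = n" "u @ y \<in> L" by blast
  with right_extendable obtain a where "(u @ y) @ [a] \<in> L" by blast
  with \<open>length y = n\<close> show ?case by (intro exI[of _ "y @ [a]"]) simp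
qed

text \<open>Reading backwards from \<open>a # w\<close>, a first disagreement between \<open>v\<close> and the return word would
  produce a left special word. That word begins with \<open>w\<close>, which is a third occurrence of \<open>w\<close> in
  \<open>R a @ w\<close>.\<close>

lemma return_backward:
  assumes rs: "return_system w R" and w: "left_special L w" and a: "a \<in> A"
    and v: "v \<in> L" "suffix (a # w) v"
  shows "suffix v (R a @ w) \<or> suffix (R a @ w) v"
proof (rule ccontr)
  note r = return_systemD[OF rs a]
  assume n: "\<not> ?thesis"
  obtain s where s: "v = s @ a # w" using v(2) by (auto simp: suffix_def)
  define s' where "s' = butlast (R a)"
  have s': "R a = s' @ [a]" using r(1,2) by (metis append_butlast_last_id s'_def)
  have "\<not> suffix s s'" "\<not> suffix s' s"
    using n s s' by (auto simp: suffix_def)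
  then obtain s1 x s2 y t where d: "s = s1 @ x # t" "s' = s2 @ y # t" "x \<noteq> y"
    using suffix_parallel_decomp by metis
  let ?z = "t @ a # w"
  have "x # ?z \<in> L" using factorial[OF v(1), of "x # ?z"] s d by auto
  moreover have "y # ?z \<in> L" using factorial[OF r(3), of "y # ?z"] s' d by auto
  moreover from calculation have "?z \<in> L"
    using factorial by (metis sublist_Cons_right sublist_order.order_refl)
  ultimately have "left_special L ?z" using d(3) unfolding left_special_def by blast
  then obtain e where e: "?z = w @ e"
    using left_special_begins[OF _ w, of ?z] unfolding prefix_def by fastforce
  then have "R a @ w = (s2 @ [y]) @ w @ e" using s' d by simp
  with r(5) have "e = []" by blast
  with e show False by (metis append_Nil2 impossible_Cons length_append le_add2)
qed

text \<open>The mirror image of the preceding argument: a first disagreement after \<open>w @ [c]\<close> would produce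
  a right special word, and it ends with a third occurrence of \<open>w\<close>.\<close>

lemma return_forward:
  assumes rs: "return_system w R" and w: "right_special L w" and a: "a \<in> A"
    and v: "v \<in> L" "prefix (w @ [c]) v" "prefix (w @ [c]) (R a @ w)"
  shows "prefix v (R a @ w) \<or> prefix (R a @ w) v"
proof (rule ccontr)
  note r = return_systemD[OF rs a]
  assume n: "\<not> ?thesis"
  obtain v' where v': "v = (w @ [c]) @ v'" using v(2) by (auto simp: prefix_def)
  obtain r' where r': "R a @ w = (w @ [c]) @ r'" using v(3) by (auto simp: prefix_def)
  have "v' \<parallel> r'" using n unfolding v' r' by (intro parallelI) simp_all
  then obtain t x xs y ys where d: "x \<noteq> y" "v' = t @ x # xs" "r' = t @ y # ys"
    using parallel_decomp by blast
  let ?z = "w @ [c] @ t"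
  have "?z @ [x] \<in> L" using factorial[OF v(1), of "?z @ [x]"] v' d
    by (metis append.assoc append_Cons append_Nil sublist_append_rightI)
  moreover have "?z @ [y] \<in> L" using factorial[OF r(3), of "?z @ [y]"] r' d
    by (metis append.assoc append_Cons append_Nil sublist_append_rightI)
  moreover from calculation have "?z \<in> L"
    using factorial sublist_append_rightI by blast
  ultimately have "right_special L ?z" using d(1) unfolding right_special_def by blast
  then obtain e where e: "?z = e @ w"
    using right_special_ends[OF _ w, of ?z] unfolding suffix_def by fastforce
  then have "R a @ w = e @ w @ (y # ys)" using r' d by (metis append.assoc)
  with r(5) have "e = []" by blast
  with e show False by (metis append_Nil append_self_conv append_is_Nil_conv not_Cons_self2)
qed

text \<open>If one complete return word is a prefix of another, then they coincide, since \<open>w\<close> occurs at the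
  end of the shorter one; and the last letter of \<open>R a\<close> is \<open>a\<close>.\<close>

lemma return_prefix_inj:
  assumes rs: "return_system w R" and "a \<in> A" "b \<in> A"
    and "prefix (R a @ w) z" "prefix (R b @ w) z"
  shows "a = b"
proof -
  have *: "a = b" if ab: "a \<in> A" "b \<in> A" "prefix (R a @ w) (R b @ w)" for a b
  proof -
    note ra = return_systemD[OF rs ab(1)] and rb = return_systemD[OF rs ab(2)]
    obtain t where "R b @ w = R a @ w @ t" using ab(3) by (auto simp: prefix_def)
    with rb(5)[of "R a" t] ra(1) have "R b = R a" by auto
    with ra(2) rb(2) show "a = b" by metis
  qed
  show ?thesis using prefix_same_cases[OF assms(4,5)] * assms(2,3) by metis
qed


text \<open>As \<open>i # w\<close> is right special, \<open>i # w @ [d]\<close> is a factor too. So \<open>w @ [d]\<close> is left special, and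
  there is only one left special word of this length.\<close>

lemma next_letter_unique:
  assumes "right_special L (i # w)" "a \<noteq> i" "a # w @ [d] \<in> L" "left_special L (w @ [c])"
  shows "d = c"
proof -
  have "d \<in> A" using alphabet[OF assms(3)] by simp
  then have "i # w @ [d] \<in> L" using right_special_full[OF assms(1)] by simp
  moreover have "w @ [d] \<in> L"
    using factorial[OF assms(3)] by (metis sublist_Cons_right sublist_order.order_refl)
  ultimately have "left_special L (w @ [d])"
    using assms(2,3) unfolding left_special_def by blast
  with assms(4) left_special_unique show ?thesis by fastforce
qed

text \<open>As a right special word, \<open>W\<close> ends with \<open>i # w\<close> and therefore with \<open>R i @ w\<close>. It remains to
  see that \<open>W\<close> also begins with \<open>R i @ w\<close>: then this word is bispecial and lies strictly above \<open>w\<close>,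
  so it is \<open>W\<close>. Both words begin with \<open>w\<close>, and \<open>return_forward\<close> reduces the claim to the letter
  that comes next.\<close>

lemma next_bispecial:
  assumes rs: "return_system w R" and w: "bispecial L w"
    and W: "bispecial L W" "length w < length W"
    and gap: "\<And>u. bispecial L u \<Longrightarrow> length w < length u \<Longrightarrow> length W \<le> length u"
    and i: "right_special L (i # w)"
  shows "W = R i @ w"
proof -
  have wl: "left_special L w" and wr: "right_special L w"
    and Wl: "left_special L W" and Wr: "right_special L W"
    using w W unfolding bispecial_def by auto
  have WL: "W \<in> L" using Wl unfolding left_special_def by blast
  have iA: "i \<in> A" using i alphabet unfolding right_special_def by fastforce
  note r = return_systemD[OF rs iA]
  have iW: "suffix (i # w) W" using right_special_ends[OF Wr i] W(2) by simp
  have lenr: "length w < length (R i @ w)" using r(1) by simp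
  have wW: "prefix w W" using left_special_begins[OF Wl wl] W(2) by simp
  \<comment> \<open>a suffix of the return word that starts with \<open>w\<close> and is longer than \<open>w\<close> is all of it\<close>
  have short: "P = R i @ w" if P: "prefix w P" "length w < length P" "suffix P (R i @ w)" for P
  proof -
    obtain s where s: "R i @ w = s @ P" using P(3) by (auto simp: suffix_def)
    obtain t where t: "P = w @ t" using P(1) by (auto simp: prefix_def)
    from s t r(5)[of s t] P(2) show ?thesis by auto
  qed
  show ?thesis
  proof (cases "suffix W (R i @ w)")
    case True
    with short wW W(2) show ?thesis by blast
  next
    case False
    then have sW: "suffix (R i @ w) W"
      using return_backward[OF rs wl iA WL iW] by blast
    then have Rr: "right_special L (R i @ w)" using right_special_suffix[OF Wr] by blast
    obtain c where c: "prefix (w @ [c]) W"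
    proof -
      obtain t where t: "W = w @ t" using wW by (auto simp: prefix_def)
      with W(2) obtain c t' where "t = c # t'" by (cases t) auto
      with t that show thesis by (auto simp: prefix_def)
    qed
    have wc: "left_special L (w @ [c])" using left_special_prefix[OF Wl c] .
    \<comment> \<open>In the shortest prefix \<open>P\<close> of \<open>W\<close> that ends with \<open>i # w\<close>, the copy of \<open>R i @ w\<close> at the end
      is either a prefix or preceded by a letter different from \<open>i\<close>. In the second case this letter
      and \<open>w\<close> leave only \<open>c\<close> as the next letter.\<close>
    have "\<exists>P. (prefix P W \<and> suffix (i # w) P) \<and>
              (\<forall>Q. prefix Q W \<and> suffix (i # w) Q \<longrightarrow> length P \<le> length Q)"
      using ex_has_least_nat[of "\<lambda>P. prefix P W \<and> suffix (i # w) P" W length] iW by simp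
    then obtain P where P: "prefix P W" "suffix (i # w) P"
      and least: "\<And>Q. prefix Q W \<Longrightarrow> suffix (i # w) Q \<Longrightarrow> length P \<le> length Q"
      by blast
    have PL: "P \<in> L" using P(1) factorial[OF WL] by blast
    have lenP: "length w < length P" using P(2) suffix_length_le by fastforce
    have wP: "prefix w P" using prefix_length_prefix[OF wW P(1)] lenP by simp
    have "suffix (R i @ w) P"
      using return_backward[OF rs wl iA PL P(2)] short[OF wP lenP] by auto
    then obtain s where s: "P = s @ R i @ w" by (auto simp: suffix_def)
    have cR: "prefix (w @ [c]) (R i @ w)"
    proof (cases s rule: rev_cases)
      case Nil
      then have "prefix (R i @ w) W" using s P(1) by simp
      with c lenr show ?thesis by (metis Suc_leI length_append_singleton prefix_length_prefix)
    next
      case (snoc s' a)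
      obtain t where t: "R i @ w = w @ t" using r(4) by (auto simp: prefix_def)
      with lenr obtain d t' where t': "t = d # t'" by (cases t) auto
      have Pd: "P = (s' @ a # w) @ d # t'" using s snoc t t' by simp
      have "a \<noteq> i"
      proof
        assume "a = i"
        have "prefix (s' @ a # w) W" using Pd P(1) by (metis prefixI prefix_order.trans)
        from least[OF this] \<open>a = i\<close> Pd show False by (auto simp: suffix_def)
      qed
      moreover have "a # w @ [d] \<in> L"
        using factorial[OF PL, of "a # w @ [d]"] Pd
        by (metis append.assoc append_Cons append_Nil sublist_appendI)
      ultimately have "d = c" using next_letter_unique[OF i _ _ wc] by blast
      with t t' show ?thesis by simp
    qed
    from return_forward[OF rs wr iA WL c cR] show ?thesis
    proof
      assume "prefix W (R i @ w)"
      with sW show ?thesis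
        using False by (metis prefix_length_le suffix_length_le le_antisym prefix_def
            append_eq_append_conv append_Nil2 suffix_order.order_refl)
    next
      assume pW: "prefix (R i @ w) W"
      then have "bispecial L (R i @ w)"
        using Rr left_special_prefix[OF Wl] unfolding bispecial_def by blast
      from gap[OF this lenr] pW show ?thesis
        by (metis prefix_length_le le_antisym prefix_def append_eq_append_conv append_Nil2)
    qed
  qed
qed

text \<open>The given factor extends to the left as far as required, and \<open>return_backward\<close> says which
  letters appear.\<close>

lemma return_word_precedes:
  assumes rs: "return_system w R" and w: "left_special L w" and a: "a \<in> A"
    and y: "a # w @ y \<in> L"
  shows "R a @ w @ y \<in> L"
proof -
  obtain z where z: "length z = length (R a)" "z @ a # w @ y \<in> L"
    using left_extend_many[OF y] by blast
  have zL: "z @ a # w \<in> L"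
    using factorial[OF z(2), of "z @ a # w"] by (metis append.assoc append_Cons sublist_append_rightI)
  have "suffix (a # w) (z @ a # w)" by (simp add: suffix_def)
  from return_backward[OF rs w a zL this] have "suffix (R a @ w) (z @ a # w)"
    using z(1) suffix_length_le by fastforce
  then have "suffix (R a) (z @ [a])"
    by (metis append.assoc append_Cons append_Nil same_suffix_suffix)
  then obtain x where "z @ [a] = x @ R a" by (auto simp: suffix_def)
  then have "z @ a # w @ y = x @ R a @ w @ y"
    by (metis append.assoc append_Cons append_Nil)
  with z(2) show ?thesis using factorial sublist_append_leftI by metis
qed

lemma return_word_occurrence:
  assumes rs: "return_system w R" and a: "a \<in> A" and y: "prefix w y"
    and st: "R a @ y = s @ w @ t" "length s < length (R a)"
  shows "s = []"
proof -
  obtain s' where s': "R a = s @ s'" "s' \<noteq> []"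
    using st by (auto simp: append_eq_append_conv2)
  have "prefix w (s' @ y)" using st s' by (metis append.assoc prefixI same_append_eq)
  moreover have "prefix (s' @ w) (s' @ y)" using y by simp
  ultimately have "prefix w (s' @ w)" by (metis prefix_length_prefix length_append le_add2)
  then obtain t' where "s' @ w = w @ t'" by (auto simp: prefix_def)
  moreover from this s'(2) have "t' \<noteq> []" by auto
  ultimately show ?thesis using return_systemD(5)[OF rs a, of s t'] s' by simp
qed

text \<open>Before \<open>R a @ W\<close> with \<open>a \<noteq> i\<close> comes the letter \<open>i\<close>. Any other letter would force \<open>R a @ w\<close> to
  continue after \<open>w\<close> as \<open>W = R i @ w\<close> does, and these two return words would be equal by
  \<open>return_forward\<close>. So \<open>R i @ R a @ W\<close> is a factor. An occurrence of \<open>W\<close> strictly inside it would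
  start with an occurrence of \<open>w\<close>, which can only be the one between the blocks \<open>R i\<close> and \<open>R a\<close>;
  but there the block \<open>R a\<close> follows and not \<open>R i\<close>.\<close>

lemma return_system_step:
  assumes rs: "return_system w R" and w: "bispecial L w"
    and W: "left_special L W" "W = R i @ w" and i: "right_special L (i # w)"
  shows "return_system W (\<lambda>a. if a = i then R i else R i @ R a)"
proof -
  have wl: "left_special L w" and wr: "right_special L w"
    using w unfolding bispecial_def by auto
  have iA: "i \<in> A" using i alphabet unfolding right_special_def by fastforce
  note r = return_systemD[OF rs iA]
  have wW: "prefix w W" using r(4) W(2) by simp
  then obtain q where q: "W = w @ q" by (auto simp: prefix_def)
  have RW: "R a @ W \<in> L" if "a \<in> A" for a
    using return_word_precedes[OF rs wl that, of q] left_special_full[OF W(1) that] q by simp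
  have ia: "R i @ R a @ W \<in> L" if a: "a \<in> A" "a \<noteq> i" for a
  proof -
    note ra = return_systemD[OF rs a(1)]
    obtain b where b: "b # R a @ W \<in> L" using left_extendable[OF RW[OF a(1)]] by blast
    obtain t where t: "R a @ w = w @ t" using ra(4) by (auto simp: prefix_def)
    with ra(1) obtain d t' where t': "t = d # t'" by (cases t) auto
    have aW: "R a @ W = w @ t @ q" using t q by simp
    have "b # R a @ W = (b # w @ [d]) @ t' @ q" using aW t' by simp
    with b have bwd: "b # w @ [d] \<in> L" using factorial sublist_append_rightI by metis
    \<comment> \<open>\<open>e\<close> is the letter after the prefix \<open>w\<close> of \<open>W\<close>, hence the one with \<open>w @ [e]\<close> left special\<close>
    obtain e q' where e: "q = e # q'" using q W(2) r(1) by (cases q) auto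
    have we: "left_special L (w @ [e])" using left_special_prefix[OF W(1)] q e by simp
    have "b = i"
    proof (rule ccontr)
      assume "b \<noteq> i"
      then have de: "d = e" using next_letter_unique[OF i _ bwd we] by blast
      have "prefix W (R a @ w) \<or> prefix (R a @ w) W"
      proof (rule return_forward[OF rs wr a(1)])
        show "W \<in> L" using W(1) unfolding left_special_def by blast
        show "prefix (w @ [e]) W" using q e by simp
        show "prefix (w @ [e]) (R a @ w)" using t t' de by simp
      qed
      then show False using return_prefix_inj[OF rs iA a(1)] a(2) W(2) by blast
    qed
    with b aW return_word_precedes[OF rs wl iA, of "t @ q"] show ?thesis by simp
  qed
  show ?thesis
    unfolding return_system_def
  proof (intro ballI)
    fix a assume a: "a \<in> A"
    note ra = return_systemD[OF rs a]
    let ?R' = "if a = i then R i else R i @ R a"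
    have L: "?R' @ W \<in> L" using RW[OF iA] ia[OF a] by simp
    have waW: "prefix w (R a @ W)" using prefix_append_trans[OF ra(4) wW] .
    have pre: "prefix W (?R' @ W)" using W(2) wW waW by simp
    have only: "s = [] \<or> t = []" if st: "?R' @ W = s @ W @ t" for s t
    proof (rule ccontr)
      assume n: "\<not> ?thesis"
      have len: "length s < length ?R'"
        using n arg_cong[OF st, of length] by (cases t) auto
      show False
      proof (cases "length s < length (R i)")
        case True
        define y where "y = (if a = i then W else R a @ W)"
        have "prefix w y" using wW waW by (simp add: y_def)
        moreover have "R i @ y = s @ w @ (q @ t)" using st q by (simp add: y_def split: if_splits)
        ultimately show False using return_word_occurrence[OF rs iA _ _ True] n by blast
      next
        case False
        with len have ai: "a \<noteq> i" by auto
        with st have eq: "R i @ R a @ W = s @ W @ t" by simp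
        have "prefix (R i) (s @ W @ t)" unfolding eq[symmetric] by simp
        then have "prefix (R i) s" by (rule prefix_length_prefix) (use False in auto)
        then obtain s' where s': "s = R i @ s'" by (auto simp: prefix_def)
        with eq have Ra: "R a @ W = s' @ W @ t" by simp
        have "length s' < length (R a)" using len ai s' by simp
        moreover have "R a @ W = s' @ w @ (q @ t)" using Ra q by simp
        ultimately have "s' = []" using return_word_occurrence[OF rs a wW] by blast
        with Ra W(2) have "prefix (R i @ w) (R a @ W)" by simp
        moreover have "prefix (R a @ w) (R a @ W)" using wW by simp
        ultimately show False using return_prefix_inj[OF rs iA a] ai by blast
      qed
    qed
    show "?R' \<noteq> [] \<and> last ?R' = a \<and> ?R' @ W \<in> L \<and> prefix W (?R' @ W) \<and>
        (\<forall>s t. ?R' @ W = s @ W @ t \<longrightarrow> s = [] \<or> t = [])"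
    proof (intro conjI allI impI)
      show "?R' \<noteq> []" "last ?R' = a" using ra(1,2) r(1) by auto
    qed (fact L, fact pre, rule only)
  qed
qed

text \<open>The extension \<open>z\<close> is chosen shortest: no occurrence of \<open>u\<close> in \<open>v @ z\<close> ends between the end of
  \<open>v\<close> and the end of \<open>v @ z\<close>.\<close>

lemma first_occurrence:
  assumes "u \<in> L" "v \<in> L"
  obtains z where "v @ z \<in> L" "suffix u (v @ z)"
    "\<And>z' t. z = z' @ t \<Longrightarrow> t \<noteq> [] \<Longrightarrow> \<not> suffix u (v @ z')"
proof -
  obtain G where G: "\<And>v. v \<in> L \<Longrightarrow> length v \<ge> G \<Longrightarrow> sublist u v"
    using recurrent[OF assms(1)] by blast
  obtain y where y: "length y = G" "v @ y \<in> L" using right_extend_many[OF assms(2)] by blast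
  then have "sublist u y" using G factorial[OF y(2)] by auto
  then obtain p q where "y = p @ u @ q" by (auto simp: sublist_def)
  with y(2) have "v @ (p @ u) \<in> L" using factorial
    by (metis append.assoc sublist_append_rightI)
  then have "v @ (p @ u) \<in> L \<and> suffix u (v @ (p @ u))" by (simp add: suffix_def)
  from ex_has_least_nat[of "\<lambda>z. v @ z \<in> L \<and> suffix u (v @ z)", OF this, of length]
  obtain z where z: "v @ z \<in> L" "suffix u (v @ z)"
    and least: "\<And>z'. v @ z' \<in> L \<Longrightarrow> suffix u (v @ z') \<Longrightarrow> length z \<le> length z'"
    by blast
  show thesis
  proof (rule that[OF z])
    fix z' t assume zt: "z = z' @ t" "t \<noteq> []"
    have "v @ z' \<in> L" using zt(1) z(1) factorial by (metis append.assoc sublist_append_rightI)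
    with least zt show "\<not> suffix u (v @ z')" by fastforce
  qed
qed

text \<open>Extend \<open>v\<close> to the right up to the first end of an occurrence of \<open>w\<close>. If this needs at least one
  letter, then the previous occurrence of \<open>w\<close> begins within \<open>v\<close>, because \<open>v\<close> is as long as any
  complete return word, and by the choice of the extension it also ends within \<open>v\<close>.\<close>

lemma long_factor_contains:
  assumes rs: "return_system w R" and w: "left_special L w"
    and v: "v \<in> L" "\<And>a. a \<in> A \<Longrightarrow> length (R a @ w) \<le> length v"
  shows "sublist w v"
proof -
  have wL: "w \<in> L" using w unfolding left_special_def by blast
  obtain e where "e # w \<in> L" using left_extendable[OF wL] by blast
  then have "e \<in> A" using alphabet by fastforce
  then have wv: "length w < length v"
    using v(2)[of e] return_systemD(1)[OF rs, of e] by (cases "R e") auto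
  obtain z where z: "v @ z \<in> L" "suffix w (v @ z)"
    and min: "\<And>z' t. z = z' @ t \<Longrightarrow> t \<noteq> [] \<Longrightarrow> \<not> suffix w (v @ z')"
    using first_occurrence[OF wL v(1)] by metis
  show ?thesis
  proof (cases "z = []")
    case True
    with z show ?thesis by simp
  next
    case False
    obtain y where y: "v @ z = y @ w" using z(2) by (auto simp: suffix_def)
    with wv have "y \<noteq> []" by (metis append_Nil length_append not_add_less1)
    then obtain y' a where "y = y' @ [a]" by (metis rev_exhaust)
    with y have ya: "suffix (a # w) (v @ z)" by (simp add: suffix_def)
    then have a: "a \<in> A" using alphabet[OF z(1)] set_mono_suffix by fastforce
    note ra = return_systemD[OF rs a]
    have "\<not> suffix (v @ z) (R a @ w)"
      using suffix_length_le[of "v @ z" "R a @ w"] v(2)[OF a] False by (cases z) auto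
    then obtain s where s: "v @ z = s @ R a @ w"
      using return_backward[OF rs w a z(1) ya] by (auto simp: suffix_def)
    obtain t where t: "R a @ w = w @ t" using ra(4) by (auto simp: prefix_def)
    with ra(1) have "t \<noteq> []" by auto
    have vz: "v @ z = (s @ w) @ t" using s t by simp
    then have "prefix (s @ w) v \<or> prefix v (s @ w)"
      by (metis prefixI prefix_same_cases)
    then show ?thesis
    proof
      assume "prefix (s @ w) v"
      then show ?thesis by (metis prefix_imp_sublist sublist_append_leftI sublist_order.order_trans)
    next
      assume "prefix v (s @ w)"
      then obtain z' where z': "s @ w = v @ z'" by (auto simp: prefix_def)
      with vz have "z = z' @ t" by simp
      from min[OF this \<open>t \<noteq> []\<close>] z' show ?thesis by (metis suffixI)
    qed
  qed
qed

text \<open>Extend \<open>u\<close> to the right up to the first end of an occurrence of \<open>w\<close>, and to the left far enough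
  for a whole return word. The previous occurrence of \<open>w\<close> ends before the end of \<open>u\<close>. Being at least
  as long as \<open>u\<close>, it starts before \<open>u\<close> does.\<close>

lemma short_factor_in_return:
  assumes rs: "return_system w R" and w: "left_special L w"
    and u: "u \<in> L" "length u \<le> length w"
  shows "\<exists>a\<in>A. sublist u (R a @ w)"
proof -
  have wL: "w \<in> L" using w unfolding left_special_def by blast
  \<comment> \<open>one letter more than \<open>w\<close>, so that some letter precedes the occurrence of \<open>w\<close> found below\<close>
  obtain y where y: "length y = Suc (length w)" "y @ u \<in> L"
    using left_extend_many[OF u(1)] by blast
  obtain z where z: "(y @ u) @ z \<in> L" "suffix w ((y @ u) @ z)"
    and min: "\<And>z' t. z = z' @ t \<Longrightarrow> t \<noteq> [] \<Longrightarrow> \<not> suffix w ((y @ u) @ z')"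
    using first_occurrence[OF wL y(2)] by metis
  obtain x where x: "(y @ u) @ z = x @ w" using z(2) by (auto simp: suffix_def)
  have "length ((y @ u) @ z) > length w" using y(1) by simp
  with x have "x \<noteq> []" by auto
  then obtain x' a where "x = x' @ [a]" by (metis rev_exhaust)
  with x have ya: "suffix (a # w) ((y @ u) @ z)" by (simp add: suffix_def)
  then have a: "a \<in> A" using alphabet[OF z(1)] set_mono_suffix by fastforce
  note ra = return_systemD[OF rs a]
  have "sublist u (R a @ w)"
    using return_backward[OF rs w a z(1) ya]
  proof
    assume "suffix ((y @ u) @ z) (R a @ w)"
    then show ?thesis by (metis append.assoc suffix_imp_sublist sublist_appendI sublist_order.order_trans)
  next
    assume "suffix (R a @ w) ((y @ u) @ z)"
    then obtain s where s: "(y @ u) @ z = s @ R a @ w" by (auto simp: suffix_def)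
    obtain t where t: "R a @ w = w @ t" using ra(4) by (auto simp: prefix_def)
    with ra(1) have "t \<noteq> []" by auto
    have vz: "(y @ u) @ z = (s @ w) @ t" using s t by simp
    have "\<not> prefix (y @ u) (s @ w)"
    proof
      assume "prefix (y @ u) (s @ w)"
      then obtain z' where z': "s @ w = (y @ u) @ z'" by (auto simp: prefix_def)
      with vz have "z = z' @ t" by simp
      from min[OF this \<open>t \<noteq> []\<close>] z' show False by (metis suffixI)
    qed
    then have "prefix (s @ w) (y @ u)" using vz by (metis prefixI prefix_same_cases)
    then have "prefix s (y @ u)" "length s \<le> length y"
      using u(2) prefix_length_le by (metis append_prefixD, fastforce)
    then obtain y' where "y = s @ y'" by (metis prefixE prefix_length_prefix prefixI)
    with s have "R a @ w = y' @ u @ z" by simp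
    then show ?thesis by simp
  qed
  with a show ?thesis by blast
qed

end

section \<open>The chain of bispecial words\<close>

text \<open>Bispecial words and index letters are numbered from 0 here, so that inductions start at the empty
  word.\<close>

locale AR_index = AR_language +
  fixes w :: "nat \<Rightarrow> nat list" and i :: "nat \<Rightarrow> nat"
  assumes w_0: "w 0 = []"
    and w_bispecial: "bispecial L (w n)"
    and w_length: "length (w n) < length (w (Suc n))"
    and w_gap: "bispecial L u \<Longrightarrow> length (w n) < length u \<Longrightarrow> length (w (Suc n)) \<le> length u"
    and i_right_special: "right_special L (i n # w n)"
begin

primrec R :: "nat \<Rightarrow> nat \<Rightarrow> nat list" where
  "R 0 a = [a]"
| "R (Suc n) a = (if a = i n then R n (i n) else R n (i n) @ R n a)"

lemma w_special: "left_special L (w n)" "right_special L (w n)" "w n \<in> L"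
  using w_bispecial[of n] unfolding bispecial_def left_special_def by auto

lemma i_in_A: "i n \<in> A"
  using i_right_special alphabet unfolding right_special_def by fastforce

lemma return_system_R: "return_system (w n) (R n)"
  and w_Suc_R: "w (Suc n) = R n (i n) @ w n"
proof -
  have next_w: "w (Suc n) = R n (i n) @ w n" if "return_system (w n) (R n)" for n
    using next_bispecial[OF that w_bispecial w_bispecial w_length w_gap i_right_special] .
  show rs: "return_system (w n) (R n)"
  proof (induction n)
    case 0
    have "[a] \<in> L" if "a \<in> A" for a
      using left_special_full[OF w_special(1)[of 0] that] w_0 by simp
    then show ?case unfolding return_system_def by (auto simp: w_0 Cons_eq_append_conv)
  next
    case (Suc n)
    have "R (Suc n) = (\<lambda>a. if a = i n then R n (i n) else R n (i n) @ R n a)" by auto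
    with return_system_step[OF Suc w_bispecial w_special(1) next_w[OF Suc] i_right_special]
    show ?case by simp
  qed
  show "w (Suc n) = R n (i n) @ w n" using next_w[OF rs] .
qed

lemmas R_props = return_systemD[OF return_system_R]

lemma prefix_w: "n \<le> m \<Longrightarrow> prefix (w n) (w m)"
proof (induction m rule: dec_induct)
  case (step m)
  have "prefix (w m) (w (Suc m))" unfolding w_Suc_R by (rule R_props(4)[OF i_in_A])
  with step.IH show ?case by (rule prefix_order.trans)
qed simp

lemma suffix_R: "n \<le> m \<Longrightarrow> suffix (R n a) (R m a)"
proof (induction m rule: dec_induct)
  case (step m)
  have "R (Suc m) a = (if a = i m then [] else R m (i m)) @ R m a" by simp
  then have "suffix (R m a) (R (Suc m) a)" by (rule suffixI)
  with step.IH show ?case by (rule suffix_order.trans)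
qed simp

lemma length_w_mono: "n \<le> m \<Longrightarrow> length (w n) \<le> length (w m)"
  using prefix_w prefix_length_le by blast

lemma length_w_ge: "n \<le> length (w n)"
proof (induction n)
  case (Suc n)
  with w_length[of n] show ?case by simp
qed simp

text \<open>A step adds the same amount, the length of \<open>R n (i n)\<close>, to the length of \<open>w n\<close> and to the length
  of each return word except that of \<open>i n\<close>, which stays as it is.\<close>

lemma length_R_le: "a \<in> A \<Longrightarrow> length (R n a) \<le> length (w n) + 1"
proof (induction n arbitrary: a)
  case (Suc n)
  then show ?case using i_in_A[of n] w_Suc_R[of n] by (auto simp: add.commute le_SucI)
qed simp

lemma length_w_growth: "length (w (n + g)) + 1 \<le> 2 ^ g * (length (w n) + 1)"
proof (induction g)
  case (Suc g)
  have "length (w (n + Suc g)) + 1 \<le> 2 * (length (w (n + g)) + 1)"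
    using length_R_le[OF i_in_A, of "n + g" "n + g"] w_Suc_R[of "n + g"] by simp
  with Suc show ?case by simp
qed simp

text \<open>\<open>w (Suc m)\<close> is \<open>R m a @ w m\<close>, in which the block ends with the older block of the same letter
  and \<open>w m\<close> begins with the older bispecial word.\<close>

lemma return_word_in_w:
  assumes "n \<le> m" "i m = a"
  shows "sublist (R n a @ w n) (w (Suc m))"
proof -
  obtain s where s: "R m a = s @ R n a" using suffix_R[OF assms(1)] by (auto simp: suffix_def)
  obtain t where t: "w m = w n @ t" using prefix_w[OF assms(1)] by (auto simp: prefix_def)
  have "w (Suc m) = s @ (R n a @ w n) @ t" using w_Suc_R[of m] assms(2) s t by simp
  then show ?thesis by (metis sublist_appendI)
qed

text \<open>Blocks of level \<open>Suc m\<close> are products of blocks of level \<open>m\<close>, and each of these is followed by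
  \<open>w m\<close>. So an occurrence of \<open>c # w n\<close> stays inside a single complete return word of level \<open>m\<close>.
  Down at level \<open>n\<close>, the second occurrence of \<open>w n\<close> in the return word of \<open>b\<close> is preceded by \<open>b\<close>.\<close>

lemma marked_occurrence_in_return:
  assumes "n \<le> m" "b \<in> A" "sublist (c # w n) (R m b @ w m)"
  shows "c = b \<or> c \<in> i ` {n..<m}"
  using assms
proof (induction m arbitrary: b rule: dec_induct)
  case base
  then obtain s t where "R n b @ w n = s @ (c # w n) @ t" by (auto simp: sublist_def)
  then have st: "R n b @ w n = (s @ [c]) @ w n @ t" by simp
  with R_props(5)[OF base(1)] have "t = []" by blast
  with st have "R n b = s @ [c]" by simp
  with R_props(2)[OF base(1), of n] show ?case by simp
next
  case (step m)
  have len: "length (w n) \<le> length (w m)" using length_w_mono step.hyps by blast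
  have i_case: "c \<in> i ` {n..<Suc m}" if "sublist (c # w n) (R m (i m) @ w m)"
    using step.IH[OF i_in_A that] step.hyps by auto
  have pre: "prefix (w m) (R m a @ w m)" if "a \<in> A" for a using R_props(4)[OF that] .
  show ?case
  proof (cases "b = i m")
    case True
    with step.prems w_Suc_R[of m]
    have "sublist (c # w n) (R m (i m) @ (R m (i m) @ w m))" by simp
    from sublist_append_overlap[OF pre[OF i_in_A] len this] i_case show ?thesis by blast
  next
    case False
    with step.prems w_Suc_R[of m]
    have *: "sublist (c # w n) (R m (i m) @ (R m b @ (R m (i m) @ w m)))" by simp
    have "prefix (w m) (R m b @ (R m (i m) @ w m))"
      using prefix_append_trans[OF pre[OF step.prems(1)] pre[OF i_in_A]] .
    from sublist_append_overlap[OF this len *]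
    have "sublist (c # w n) (R m (i m) @ w m) \<or> sublist (c # w n) (R m b @ w m)"
      using sublist_append_overlap[OF pre[OF i_in_A] len] by blast
    then show ?thesis using i_case step.IH[OF step.prems(1)] step.hyps by auto
  qed
qed

lemma marked_occurrence:
  assumes "n \<le> m" "sublist (c # w n) (w m)"
  shows "c \<in> i ` {n..<m}"
proof -
  have "length (w n) < length (w m)" using sublist_length_le[OF assms(2)] by simp
  with assms(1) obtain l where l: "m = Suc l" "n \<le> l"
    by (metis le_neq_implies_less less_irrefl less_imp_Suc_add le_add1)
  from marked_occurrence_in_return[OF l(2) i_in_A, of c l] assms(2) w_Suc_R[of l] l
  show ?thesis by auto
qed

section \<open>Bounded gaps and linear recurrence\<close>

lemma bounded_gaps_imp_linear:
  assumes g: "\<And>a m. a \<in> A \<Longrightarrow> \<exists>j\<in>{m..<m + g}. i j = a"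
    and u: "u \<in> L" and v: "v \<in> L" "2 ^ (g + 2) * length u \<le> length v"
  shows "sublist u v"
proof (cases "u = []")
  case False
  \<comment> \<open>the level at which \<open>u\<close> fits: \<open>length (w (n - 1)) < length u \<le> length (w n)\<close>\<close>
  define n where "n = (LEAST n. length u \<le> length (w n))"
  have n: "length u \<le> length (w n)"
    unfolding n_def by (rule LeastI[of _ "length u"]) (rule length_w_ge)
  then have "n \<noteq> 0" using False w_0 by (intro notI) simp
  then obtain p where p: "n = Suc p" by (cases n) auto
  then have up: "length (w p) < length u"
    using not_less_Least[of p "\<lambda>n. length u \<le> length (w n)"] unfolding n_def by simp
  let ?N = "n + g"
  have long: "length (R ?N a @ w ?N) \<le> length v" if "a \<in> A" for a
  proof -
    have "length (R ?N a @ w ?N) \<le> 2 * (length (w ?N) + 1)"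
      using length_R_le[OF that, of ?N] by simp
    also have "\<dots> \<le> 2 * (2 ^ (g + 1) * (length (w p) + 1))"
      using length_w_growth[of p "g + 1"] p by simp
    also have "\<dots> \<le> 2 * (2 ^ (g + 1) * length u)"
      using up by (intro mult_left_mono) auto
    finally show ?thesis using v(2) by simp
  qed
  obtain a where a: "a \<in> A" "sublist u (R n a @ w n)"
    using short_factor_in_return[OF return_system_R w_special(1) u n] by blast
  obtain m where m: "n \<le> m" "m < ?N" "i m = a" using g[OF a(1), of n] by auto
  note a(2)
  also have "sublist (R n a @ w n) (w (Suc m))" using return_word_in_w m by blast
  also have "sublist (w (Suc m)) (w ?N)" using prefix_w[of "Suc m" ?N] m by auto
  also have "sublist (w ?N) v"
    using long_factor_contains[OF return_system_R w_special(1) v(1) long] .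
  finally show ?thesis .
qed simp

text \<open>Otherwise all factors of length \<open>length (R n a)\<close> occur in \<open>w n\<close>. This number is a period of
  \<open>w n\<close>, which therefore has too few factors of that length.\<close>

lemma return_words_long:
  fixes K :: real
  assumes K: "\<And>u v. u \<in> L \<Longrightarrow> v \<in> L \<Longrightarrow> K * length u \<le> length v \<Longrightarrow> sublist u v"
    and a: "a \<in> A"
  shows "length (w n) < K * length (R n a)"
proof (rule ccontr)
  assume n: "\<not> ?thesis"
  let ?p = "length (R n a)"
  let ?S = "{u. length u = ?p \<and> sublist u (w n)}"
  have "{u \<in> L. length u = ?p} \<subseteq> ?S" using K[OF _ w_special(3)[of n]] n by auto
  then have "card {u \<in> L. length u = ?p} \<le> ?p"
    using card_factors_of_periodic[OF R_props(4)[OF a, of n] R_props(1)[OF a, of n], of ?p]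
      card_mono order_trans by blast
  with many_factors[of ?p] R_props(1)[OF a, of n] show False by (cases "R n a") auto
qed

lemma linear_imp_bounded_gaps:
  fixes K :: real
  assumes K: "\<And>u v. u \<in> L \<Longrightarrow> v \<in> L \<Longrightarrow> K * length u \<le> length v \<Longrightarrow> sublist u v"
    and pos: "K > 0"
  shows "\<exists>g\<ge>1. \<forall>a\<in>A. \<forall>m. \<exists>j\<in>{m..<m + g}. i j = a"
proof -
  define q where "q = 1 + 1 / K"
  have q: "q > 1" using pos by (simp add: q_def)
  have growth: "q ^ g * length (w n) \<le> length (w (n + g))" for n g
  proof (induction g)
    case (Suc g)
    have "length (w (n + g)) \<le> K * length (R (n + g) (i (n + g)))"
      using return_words_long[OF K i_in_A] by (simp add: less_imp_le)
    then have "length (w (n + g)) / K \<le> length (R (n + g) (i (n + g)))"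
      using pos by (simp add: field_simps)
    then have "q * length (w (n + g)) \<le> length (w (n + Suc g))"
      using w_Suc_R[of "n + g"] by (simp add: q_def field_simps)
    moreover have "q * (q ^ g * length (w n)) \<le> q * length (w (n + g))"
      using Suc q by (intro mult_left_mono) auto
    ultimately show ?case by simp
  qed simp
  obtain g where g: "K < q ^ g" using real_arch_pow[OF q] by blast
  show ?thesis
    \<comment> \<open>the first step to \<open>w (Suc m)\<close> pays for the letter \<open>a\<close>, the other \<open>g\<close> steps for the factor \<open>K\<close>\<close>
  proof (intro exI[of _ "Suc g"] conjI ballI allI)
    fix a m assume a: "a \<in> A"
    have "a # w m \<in> L" using left_special_full[OF w_special(1) a] .
    moreover have "K * length (a # w m) \<le> length (w (m + Suc g))"
    proof -
      have "K * length (a # w m) \<le> K * length (w (Suc m))"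
        using pos w_length[of m] by (intro mult_left_mono) auto
      also have "\<dots> \<le> q ^ g * length (w (Suc m))"
        using g mult_right_mono[of K "q ^ g" "length (w (Suc m))"] by simp
      also have "\<dots> \<le> length (w (Suc m + g))" by (rule growth)
      finally show ?thesis by simp
    qed
    ultimately have "sublist (a # w m) (w (m + Suc g))" using K w_special(3) by blast
    from marked_occurrence[OF _ this] show "\<exists>j\<in>{m..<m + Suc g}. i j = a" by auto
  qed simp
qed

end

section \<open>Arnoux-Rauzy subshifts\<close>

text \<open>If \<open>T\<close> maps onto \<open>S\<close> and only one fibre has several elements, that fibre accounts for
  the whole excess of \<open>card T\<close> over \<open>card S\<close>.\<close>

lemma card_single_large_fibre:
  assumes "finite T" "f ` T = S" "s0 \<in> S"
    and "\<And>s. s \<in> S \<Longrightarrow> s \<noteq> s0 \<Longrightarrow> card {t \<in> T. f t = s} \<le> 1"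
  shows "card T + 1 = card S + card {t \<in> T. f t = s0}"
proof -
  have S: "finite S" using assms(1,2) by blast
  have one: "card {t \<in> T. f t = s} = 1" if "s \<in> S - {s0}" for s
  proof -
    have "{t \<in> T. f t = s} \<noteq> {}" using that assms(2) by auto
    then have "card {t \<in> T. f t = s} \<noteq> 0" using assms(1) by simp
    with assms(4)[of s] that show ?thesis by simp
  qed
  have "card T = (\<Sum>s\<in>S. card {t \<in> T. f t = s})"
    using sum.group[OF assms(1) S, of f "\<lambda>_. 1::nat"] assms(2) by simp
  also have "\<dots> = card {t \<in> T. f t = s0} + (\<Sum>s\<in>S - {s0}. 1)"
    using one by (simp add: sum.remove[OF S assms(3)])
  also have "(\<Sum>s\<in>S - {s0}. 1) = card (S - {s0})" by simp
  finally show ?thesis using card_Suc_Diff1[OF S assms(3)] by simp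
qed

text \<open>The complexity grows by \<open>k - 1\<close> from each length to the next, and only one word of each length
  has more than one extension; so this word has \<open>k\<close> extensions. The function \<open>ext\<close> stands for adding
  a letter on either side and \<open>f\<close> for removing it, so that one count serves left and right special
  words.\<close>

lemma unique_special_extends_fully:
  fixes ext :: "nat list \<Rightarrow> nat \<Rightarrow> nat list"
  assumes card: "\<And>n. card {u \<in> L. length u = n} = (k - 1) * n + 1" and k: "k \<ge> 1"
    and ext: "\<And>u a. length (ext u a) = Suc (length u)" "\<And>u. inj (ext u)" "\<And>u a. f (ext u a) = u"
    and dec: "\<And>v. v \<in> L \<Longrightarrow> v \<noteq> [] \<Longrightarrow> \<exists>u\<in>L. \<exists>a\<in>{1..k}. v = ext u a"
    and extendable: "\<And>u. u \<in> L \<Longrightarrow> \<exists>a. ext u a \<in> L"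
    and unique: "\<And>s b b'. s \<in> L \<Longrightarrow> length s = length u \<Longrightarrow> b \<noteq> b' \<Longrightarrow>
      ext s b \<in> L \<Longrightarrow> ext s b' \<in> L \<Longrightarrow> s = u"
    and u: "u \<in> L" and a: "a \<in> {1..k}"
  shows "ext u a \<in> L"
proof -
  let ?F = "\<lambda>n. {u \<in> L. length u = n}"
  let ?n = "length u"
  let ?E = "{t \<in> ?F (Suc ?n). f t = u}"
  have fin: "finite (?F n)" for n
    using card[of n] card.infinite[of "?F n"] by (metis add_is_0 one_neq_zero)
  have dec': "\<exists>a\<in>{1..k}. v = ext (f v) a \<and> f v \<in> ?F n" if "v \<in> ?F (Suc n)" for v n
  proof -
    have "v \<in> L" "v \<noteq> []" using that by auto
    then obtain s a where "s \<in> L" "a \<in> {1..k}" "v = ext s a" using dec by blast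
    with that ext show ?thesis by auto
  qed
  have f: "f ` ?F (Suc ?n) = ?F ?n"
  proof
    show "f ` ?F (Suc ?n) \<subseteq> ?F ?n" using dec' by blast
    show "?F ?n \<subseteq> f ` ?F (Suc ?n)"
    proof
      fix s assume s: "s \<in> ?F ?n"
      then obtain b where "ext s b \<in> L" using extendable by blast
      with s ext(1) have "ext s b \<in> ?F (Suc ?n)" by simp
      then have "f (ext s b) \<in> f ` ?F (Suc ?n)" by (rule imageI)
      then show "s \<in> f ` ?F (Suc ?n)" unfolding ext(3) .
    qed
  qed
  have "card {t \<in> ?F (Suc ?n). f t = s} \<le> 1" if s: "s \<in> ?F ?n" "s \<noteq> u" for s
  proof -
    have "t = t'" if t: "t \<in> {t \<in> ?F (Suc ?n). f t = s}" "t' \<in> {t \<in> ?F (Suc ?n). f t = s}" for t t'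
    proof -
      obtain b where b: "t = ext s b" using t(1) dec'[of t ?n] by auto
      obtain b' where b': "t' = ext s b'" using t(2) dec'[of t' ?n] by auto
      show "t = t'" using unique[of s b b'] s t b b' by auto
    qed
    moreover have "finite {t \<in> ?F (Suc ?n). f t = s}"
      using fin[of "Suc ?n"] by (rule rev_finite_subset) blast
    ultimately show ?thesis unfolding One_nat_def by (subst card_le_Suc0_iff_eq) blast+
  qed
  with card_single_large_fibre[OF fin f, of u] u
  have "card (?F (Suc ?n)) + 1 = card (?F ?n) + card ?E" by simp
  then have cE: "card ?E = k" unfolding card using k by simp
  have sub: "?E \<subseteq> ext u ` {1..k}" using dec'[of _ ?n] by blast
  have cI: "card (ext u ` {1..k}) = k"
    using ext(2) by (simp add: card_image inj_on_subset[OF _ subset_UNIV])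
  have "?E = ext u ` {1..k}"
    by (rule card_subset_eq[OF finite_imageI[OF finite_atLeastAtMost] sub trans[OF cE cI[symmetric]]])
  with a show ?thesis by blast
qed

lemma word_at_length [simp]: "length (word_at x p n) = n"
  by (simp add: word_at_def)

lemma word_at_1 [simp]: "word_at x p 1 = [x p]"
  by (simp add: word_at_def)

lemma word_at_append: "word_at x p (m + n) = word_at x p m @ word_at x (p + of_nat m) n"
proof -
  have "map (\<lambda>j. x (p + of_nat j)) [m..<m + n] = map (\<lambda>j. x (p + of_nat m + of_nat j)) [0..<n]"
    by (rule nth_equalityI) (auto simp: algebra_simps)
  then show ?thesis using upt_add_eq_append[of 0 m n] by (simp add: word_at_def)
qed

lemma factors_iff: "u \<in> factors x \<longleftrightarrow> (\<exists>p n. u = word_at x p n)"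
  unfolding factors_def factors_of_length_def by auto

lemma factors_of_length_eq: "factors_of_length x n = {u \<in> factors x. length u = n}"
  by (auto simp: factors_iff factors_of_length_def)

lemma factors_sublist:
  assumes "v \<in> factors x" "sublist u v"
  shows "u \<in> factors x"
proof -
  obtain s t where v: "v = s @ u @ t" using assms(2) by (auto simp: sublist_def)
  obtain p n where p: "v = word_at x p n" using assms(1) factors_iff by blast
  then have "n = length s + (length u + length t)"
    using v by (metis length_append word_at_length)
  with p v have "s @ (u @ t) = word_at x p (length s) @
      (word_at x (p + of_nat (length s)) (length u) @
       word_at x (p + of_nat (length s) + of_nat (length u)) (length t))"
    by (simp only: word_at_append)
  then have "u = word_at x (p + of_nat (length s)) (length u)"
    by (metis append_eq_append_conv word_at_length)
  then show ?thesis unfolding factors_iff by blast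
qed

lemma AR_sequence_language:
  fixes x :: "'p::semiring_1 \<Rightarrow> nat"
  assumes x: "AR_sequence k x" and k: "k \<ge> 2"
  shows "AR_language (factors x) {1..k}"
proof -
  let ?L = "factors x"
  have range: "range x \<subseteq> {1..k}" and ur: "uniformly_recurrent x"
    and card1: "\<And>n. n \<ge> 1 \<Longrightarrow> card (factors_of_length x n) = (k - 1) * n + 1"
    and rs1: "\<And>n. n \<ge> 1 \<Longrightarrow> \<exists>!u. u \<in> factors_of_length x n \<and> right_special ?L u"
    and ls1: "\<And>n. n \<ge> 1 \<Longrightarrow> \<exists>!u. u \<in> factors_of_length x n \<and> left_special ?L u"
    using x unfolding AR_sequence_def by auto
  have "x p \<in> {1..k}" for p using range by blast
  then have alph: "set u \<subseteq> {1..k}" if "u \<in> ?L" for u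
    using that unfolding factors_iff word_at_def by auto
  have left: "\<exists>a. a # u \<in> ?L" if u: "u \<in> ?L" for u
  proof -
    \<comment> \<open>in a one-sided sequence the factor at position 0 has no left neighbour, but by recurrence it
      occurs again at a position of the form \<open>1 + j\<close>\<close>
    obtain j where "word_at x (1 + of_nat j) (length u) = u"
      using ur u unfolding uniformly_recurrent_def by blast
    then have "word_at x (of_nat j) (1 + length u) = x (of_nat j) # u"
      unfolding word_at_append word_at_1 by (simp add: add.commute)
    then have "x (of_nat j) # u \<in> ?L" unfolding factors_iff by metis
    then show ?thesis by blast
  qed
  have right: "\<exists>a. u @ [a] \<in> ?L" if u: "u \<in> ?L" for u
  proof -
    obtain p n where p: "u = word_at x p n" using u factors_iff by blast
    have "word_at x p (n + 1) = u @ [x (p + of_nat n)]"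
      unfolding word_at_append word_at_1 p ..
    then have "u @ [x (p + of_nat n)] \<in> ?L" unfolding factors_iff by metis
    then show ?thesis by blast
  qed
  have recur: "\<exists>G. \<forall>v\<in>?L. length v \<ge> G \<longrightarrow> sublist u v" if u: "u \<in> ?L" for u
  proof -
    obtain g where g: "\<And>p. \<exists>j<g. word_at x (p + of_nat j) (length u) = u"
      using ur u unfolding uniformly_recurrent_def by blast
    have "sublist u v" if v: "v \<in> ?L" "length v \<ge> g + length u" for v
    proof -
      obtain p n where p: "v = word_at x p n" using v(1) factors_iff by blast
      obtain j where j: "j < g" "word_at x (p + of_nat j) (length u) = u" using g by blast
      have "j + length u \<le> n" using v(2) j(1) p by simp
      then obtain e where "n = j + (length u + e)" by (metis add.assoc le_Suc_ex)
      with p have "v = word_at x p (j + (length u + e))" by simp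
      then have "v = word_at x p j @ u @ word_at x (p + of_nat j + of_nat (length u)) e"
        unfolding word_at_append j(2) .
      then show ?thesis by (metis sublist_appendI)
    qed
    then show ?thesis by blast
  qed
  have F0: "factors_of_length x 0 = {[]}" by (auto simp: factors_of_length_def word_at_def)
  have card_L: "card {u \<in> ?L. length u = n} = (k - 1) * n + 1" for n
    unfolding factors_of_length_eq[symmetric] using card1[of n] F0 by (cases "n = 0") auto
  have rs_uniq: "u = v" if "right_special ?L u" "right_special ?L v" "length u = length v" for u v
  proof (cases "u = []")
    case False
    then have "\<exists>!y. y \<in> factors_of_length x (length u) \<and> right_special ?L y"
      using rs1[of "length u"] by (cases u) auto
    moreover have "u \<in> factors_of_length x (length u)" "v \<in> factors_of_length x (length u)"
      using that by (auto simp: factors_of_length_eq right_special_def)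
    ultimately show ?thesis using that by blast
  qed (use that in simp)
  have ls_uniq: "u = v" if "left_special ?L u" "left_special ?L v" "length u = length v" for u v
  proof (cases "u = []")
    case False
    then have "\<exists>!y. y \<in> factors_of_length x (length u) \<and> left_special ?L y"
      using ls1[of "length u"] by (cases u) auto
    moreover have "u \<in> factors_of_length x (length u)" "v \<in> factors_of_length x (length u)"
      using that by (auto simp: factors_of_length_eq left_special_def)
    ultimately show ?thesis using that by blast
  qed (use that in simp)
  show ?thesis
  proof
    show "u \<in> ?L" if "v \<in> ?L" "sublist u v" for u v using that by (rule factors_sublist)
    show "set u \<subseteq> {1..k}" if "u \<in> ?L" for u using that by (rule alph)
    show "\<exists>a. a # u \<in> ?L" if "u \<in> ?L" for u using that by (rule left)
    show "\<exists>a. u @ [a] \<in> ?L" if "u \<in> ?L" for u using that by (rule right)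
    show "\<exists>G. \<forall>v\<in>?L. length v \<ge> G \<longrightarrow> sublist u v" if "u \<in> ?L" for u using that by (rule recur)
    show "u = v" if "right_special ?L u" "right_special ?L v" "length u = length v" for u v
      using that by (rule rs_uniq)
    show "u = v" if "left_special ?L u" "left_special ?L v" "length u = length v" for u v
      using that by (rule ls_uniq)
    show "u @ [a] \<in> ?L" if u: "right_special ?L u" and a: "a \<in> {1..k}" for u a
    proof (rule unique_special_extends_fully[where ext = "\<lambda>u a. u @ [a]" and f = butlast])
      show "\<exists>u\<in>?L. \<exists>a\<in>{1..k}. v = u @ [a]" if "v \<in> ?L" "v \<noteq> []" for v
        using that alph[OF that(1)] factors_sublist[OF that(1) sublist_butlast]
        by (cases v rule: rev_cases) auto
      show "s = u" if "s \<in> ?L" "length s = length u" "b \<noteq> b'" "s @ [b] \<in> ?L" "s @ [b'] \<in> ?L"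
        for s b b'
        using rs_uniq[OF _ u] that unfolding right_special_def by blast
      show "\<exists>a. u @ [a] \<in> ?L" if "u \<in> ?L" for u using that by (rule right)
      show "inj (\<lambda>a. u @ [a])" for u :: "nat list" by (rule injI) simp
      show "u \<in> ?L" using u unfolding right_special_def by blast
    qed (use a card_L k in simp_all)
    show "a # u \<in> ?L" if u: "left_special ?L u" and a: "a \<in> {1..k}" for u a
    proof (rule unique_special_extends_fully[where ext = "\<lambda>u a. a # u" and f = tl])
      show "\<exists>u\<in>?L. \<exists>a\<in>{1..k}. v = a # u" if "v \<in> ?L" "v \<noteq> []" for v
        using that alph[OF that(1)] factors_sublist[OF that(1) sublist_tl] by (cases v) auto
      show "s = u" if "s \<in> ?L" "length s = length u" "b \<noteq> b'" "b # s \<in> ?L" "b' # s \<in> ?L"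
        for s b b'
        using ls_uniq[OF _ u] that unfolding left_special_def by blast
      show "\<exists>a. a # u \<in> ?L" if "u \<in> ?L" for u using that by (rule left)
      show "inj (\<lambda>a. a # u)" for u :: "nat list" by (rule injI) simp
      show "u \<in> ?L" using u unfolding left_special_def by blast
    qed (use a card_L k in simp_all)
    show "n < card {u \<in> ?L. length u = n}" if "n \<ge> 1" for n
    proof -
      have "1 * n \<le> (k - 1) * n" using k by (intro mult_le_mono1) simp
      then show ?thesis unfolding card_L by linarith
    qed
  qed
qed

lemma AR_subshift_language:
  fixes X :: "('p::semiring_1 \<Rightarrow> nat) set"
  assumes "AR_subshift k X"
  obtains x :: "'p \<Rightarrow> nat" where "AR_sequence k x" "language X = factors x"
proof -
  obtain x :: "'p \<Rightarrow> nat" where x: "AR_sequence k x"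
    and X: "X = {y. range y \<subseteq> {1..k} \<and> (\<forall>n\<ge>1. factors_of_length y n = factors_of_length x n)}"
    using assms unfolding AR_subshift_def by blast
  have "factors y = factors x" if "y \<in> X" for y
  proof -
    have "factors_of_length y n = factors_of_length x n" for n
      using that X by (cases "n = 0") (auto simp: factors_of_length_def word_at_def)
    then show ?thesis by (simp add: factors_def)
  qed
  moreover have "x \<in> X" using x X unfolding AR_sequence_def by blast
  ultimately have "language X = factors x" unfolding language_def by blast
  with x that show thesis by blast
qed

lemma linearly_recurrent_iff_bounded_gaps:
  fixes X :: "('p::semiring_1 \<Rightarrow> nat) set"
  assumes k: "k \<ge> 2" and X: "AR_subshift k X" and i: "index_sequence X i"
  shows "linearly_recurrent X \<longleftrightarrow> bounded_gaps k i"
proof -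
  obtain x :: "'p \<Rightarrow> nat" where x: "AR_sequence k x" and lang: "language X = factors x"
    using AR_subshift_language[OF X] by blast
  let ?L = "language X"
  interpret AR_language ?L "{1..k}" unfolding lang by (rule AR_sequence_language[OF x k])
  obtain w where w: "w 1 = []" "w ` {1..} = {u. bispecial ?L u}"
      "\<And>n. n \<ge> 1 \<Longrightarrow> length (w n) < length (w (n + 1))"
      "\<And>n a. n \<ge> 1 \<Longrightarrow> right_special ?L (a # w n) \<longleftrightarrow> a = i n"
    using i unfolding index_sequence_def bispecial_enumeration_def by metis
  \<comment> \<open>from the numbering from 1 to the numbering from 0\<close>
  let ?w = "\<lambda>n. w (Suc n)" and ?i = "\<lambda>n. i (Suc n)"
  have mono: "strict_mono (\<lambda>n. length (?w n))" using w(3) by (simp add: strict_mono_Suc_iff)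
  interpret AR_index ?L "{1..k}" ?w ?i
  proof
    fix u n assume u: "bispecial ?L u" and len: "length (?w n) < length u"
    then obtain m where "m \<in> {1..}" "u = w m" using w(2) by blast
    then obtain l where l: "u = ?w l" by (cases m) auto
    with len have "n < l" using strict_mono_less[OF mono] by simp
    then have "Suc n \<le> l" by simp
    then show "length (?w (Suc n)) \<le> length u" unfolding l using strict_mono_less_eq[OF mono] by blast
  qed (use w in auto)
  show ?thesis
  proof
    assume "linearly_recurrent X"
    then obtain K :: real where "K > 0"
      and K: "\<And>u v. u \<in> ?L \<Longrightarrow> v \<in> ?L \<Longrightarrow> K * length u \<le> length v \<Longrightarrow> sublist u v"
      unfolding linearly_recurrent_def by blast
    from linear_imp_bounded_gaps[OF K \<open>K > 0\<close>]
    obtain g where g: "g \<ge> 1" "\<And>a m. a \<in> {1..k} \<Longrightarrow> \<exists>j\<in>{m..<m + g}. i (Suc j) = a"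
      by blast
    have "\<exists>j\<in>{m..<m + g}. i j = a" if am: "a \<in> {1..k}" "m \<ge> 1" for a m
    proof -
      obtain j where "j \<in> {m - 1..<m - 1 + g}" "i (Suc j) = a" using g(2) am(1) by blast
      then show ?thesis using am(2) by (intro bexI[of _ "Suc j"]) auto
    qed
    with g(1) show "bounded_gaps k i" unfolding bounded_gaps_def by blast
  next
    assume "bounded_gaps k i"
    then obtain g where g: "\<And>a m. a \<in> {1..k} \<Longrightarrow> m \<ge> 1 \<Longrightarrow> \<exists>j\<in>{m..<m + g}. i j = a"
      unfolding bounded_gaps_def by blast
    have "\<exists>j\<in>{m..<m + g}. i (Suc j) = a" if a: "a \<in> {1..k}" for a m
    proof -
      obtain j where "j \<in> {Suc m..<Suc m + g}" "i j = a" using g[OF a, of "Suc m"] by auto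
      then show ?thesis by (intro bexI[of _ "j - 1"]) auto
    qed
    then have lin: "sublist u v" if "u \<in> ?L" "v \<in> ?L" "2 ^ (g + 2) * length u \<le> length v" for u v
      using bounded_gaps_imp_linear that by blast
    have "sublist u v" if uv: "u \<in> ?L" "v \<in> ?L"
      and len: "real (length v) \<ge> 2 ^ (g + 2) * real (length u)" for u v
    proof (rule lin[OF uv])
      have "real (2 ^ (g + 2) * length u) \<le> real (length v)" using len by simp
      then show "2 ^ (g + 2) * length u \<le> length v" by (simp only: of_nat_le_iff)
    qed
    then show "linearly_recurrent X"
      unfolding linearly_recurrent_def by (intro exI[of _ "2 ^ (g + 2)"]) auto
  qed
qed

theorem theorem3p1:
  fixes k :: nat
  assumes "k \<ge> 2"
  shows
    "(\<forall>(X :: (nat \<Rightarrow> nat) set) i. AR_subshift k X \<and> index_sequence X i \<longrightarrow>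
        (linearly_recurrent X \<longleftrightarrow> bounded_gaps k i)) \<and>
     (\<forall>(X :: (int \<Rightarrow> nat) set) i. AR_subshift k X \<and> index_sequence X i \<longrightarrow>
        (linearly_recurrent X \<longleftrightarrow> bounded_gaps k i))"
  by (intro conjI allI impI; elim conjE; rule linearly_recurrent_iff_bounded_gaps[OF assms])

end
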